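(* a) The lattice $\mathcal P(\mathbb R)$, endowed with the lattice order $\leq_{\rm st}$, is Dedekind super complete. b) Let $M\subset\mathcal P(\mathbb R)$ be nonempty. If $M$ is bounded above and directed upwards, then there exists a sequence $(\mu^n)_{n\in\mathbb N}\subset M$ with $\mu^n\leq_{\rm st}\mu^{n+1}$ for all $n\in\mathbb N$ and $\mu^n\to\sup M$ weakly as $n\to\infty$. If $M$ is bounded below and directed downwards, then there exists a sequence $(\mu^n)_{n\in\mathbb N}\subset M$ with $\mu^n\geq_{\rm st}\mu^{n+1}$ for all $n\in\mathbb N$ and $\mu^n\to\inf M$ weakly as $n\to\infty$.
   Context: $\mathcal P(\mathbb R)$ is the set of all Borel probability measures on $\mathbb R$. For $\mu\in\mathcal P(\mathbb R)$ let $\mu_0(s):=\mu((s,\infty))$, $s\in\mathbb R$. First order stochastic dominance is the partial order $\mu\leq_{\rm st}\nu$ iff $\mu_0(s)\leq\nu_0(s)$ for all $s\in\mathbb R$; it makes $\mathcal P(\mathbb R)$ a lattice, with join and meet given by the pointwise maximum and minimum of the functions $\mu_0,\nu_0$. Boundedness, directedness, suprema and infima refer to $\leq_{\rm st}$. A lattice $L$ is Dedekind super complete if every nonempty subset of $L$ that is bounded above (respectively below) has a least upper bound (respectively greatest lower bound) and has a countable subset with the same least upper bound (respectively greatest lower bound). A subset $M$ of a lattice is directed upwards (respectively downwards) if for all $x,y\in M$ there is $z\in M$ with $x\vee y\leq z$ (respectively $x\wedge y\geq z$). *)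

theory Defs
  imports "HOL-Probability.Probability" "HOL-Algebra.Lattice"
begin

definition upper_tail :: "real measure \<Rightarrow> real \<Rightarrow> real" where
  "upper_tail \<mu> s = measure \<mu> {s<..}"

definition le_st :: "real measure \<Rightarrow> real measure \<Rightarrow> bool" where
  "le_st \<mu> \<nu> \<longleftrightarrow> (\<forall>s. upper_tail \<mu> s \<le> upper_tail \<nu> s)"

definition prob_st :: "real measure gorder" where
  "prob_st = \<lparr>carrier = {\<mu>. real_distribution \<mu>}, eq = (=), le = le_st\<rparr>"

locale dedekind_super_complete_lattice = lattice +
  assumes countable_lub:
    "\<And>A. A \<subseteq> carrier L \<Longrightarrow> A \<noteq> {} \<Longrightarrow> Upper L A \<noteq> {} \<Longrightarrow>
      \<exists>s. is_lub L s A \<and> (\<exists>C. C \<subseteq> A \<and> countable C \<and> is_lub L s C)"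
  and countable_glb:
    "\<And>A. A \<subseteq> carrier L \<Longrightarrow> A \<noteq> {} \<Longrightarrow> Lower L A \<noteq> {} \<Longrightarrow>
      \<exists>i. is_glb L i A \<and> (\<exists>C. C \<subseteq> A \<and> countable C \<and> is_glb L i C)"

definition directed_up :: "('a, 'b) gorder_scheme \<Rightarrow> 'a set \<Rightarrow> bool" where
  "directed_up L M \<longleftrightarrow> (\<forall>x\<in>M. \<forall>y\<in>M. \<exists>z\<in>M. x \<squnion>\<^bsub>L\<^esub> y \<sqsubseteq>\<^bsub>L\<^esub> z)"

definition directed_down :: "('a, 'b) gorder_scheme \<Rightarrow> 'a set \<Rightarrow> bool" where
  "directed_down L M \<longleftrightarrow> (\<forall>x\<in>M. \<forall>y\<in>M. \<exists>z\<in>M. z \<sqsubseteq>\<^bsub>L\<^esub> x \<sqinter>\<^bsub>L\<^esub> y)"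

text \<open>Weak convergence is the library's \<^const>\<open>weak_conv_m\<close>, which is phrased through distribution
  functions. On probability measures it is convergence of the integrals of all bounded continuous
  functions:\<close>

lemma weak_conv_m_iff_integral:
  assumes "\<And>n. real_distribution (\<mu> n)" "real_distribution \<nu>"
  shows "weak_conv_m \<mu> \<nu> \<longleftrightarrow>
    (\<forall>f :: real \<Rightarrow> real. continuous_on UNIV f \<and> bounded (range f) \<longrightarrow>
      (\<lambda>n. integral\<^sup>L (\<mu> n) f) \<longlonglongrightarrow> integral\<^sup>L \<nu> f)"
proof
  assume w: "weak_conv_m \<mu> \<nu>"
  show "\<forall>f :: real \<Rightarrow> real. continuous_on UNIV f \<and> bounded (range f) \<longrightarrow>
      (\<lambda>n. integral\<^sup>L (\<mu> n) f) \<longlonglongrightarrow> integral\<^sup>L \<nu> f"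
  proof (intro allI impI)
    fix f :: "real \<Rightarrow> real"
    assume f: "continuous_on UNIV f \<and> bounded (range f)"
    then obtain B where B: "\<And>x. norm (f x) \<le> B"
      by (auto simp: bounded_iff)
    have "\<And>x. isCont f x"
      using f by (simp add: continuous_on_eq_continuous_at)
    from weak_conv_imp_integral_bdd_continuous_conv[OF assms w this B]
    show "(\<lambda>n. integral\<^sup>L (\<mu> n) f) \<longlonglongrightarrow> integral\<^sup>L \<nu> f" .
  qed
next
  assume r: "\<forall>f :: real \<Rightarrow> real. continuous_on UNIV f \<and> bounded (range f) \<longrightarrow>
      (\<lambda>n. integral\<^sup>L (\<mu> n) f) \<longlonglongrightarrow> integral\<^sup>L \<nu> f"
  show "weak_conv_m \<mu> \<nu>"
  proof (rule integral_bdd_continuous_conv_imp_weak_conv[OF assms])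
    fix f :: "real \<Rightarrow> real"
    assume "\<And>x. isCont f x" "\<And>x. \<bar>f x\<bar> \<le> 1"
    then have "continuous_on UNIV f \<and> bounded (range f)"
      by (auto simp: continuous_on_eq_continuous_at bounded_iff intro!: exI[of _ 1])
    with r show "(\<lambda>n. integral\<^sup>L (\<mu> n) f) \<longlonglongrightarrow> integral\<^sup>L \<nu> f" by blast
  qed
qed

end

theory Submission
  imports Defs
begin

text \<open>On distribution functions the stochastic order is the reversed pointwise order, and by right
  continuity it only has to be tested at rational points. So the supremum of \<open>M\<close> is obtained from the
  pointwise infimum of the distribution functions, the infimum from the right-continuous
  regularisation of their pointwise supremum, and a countable subset of \<open>M\<close> that realises these
  bounds at each rational point has the same upper and lower bounds as \<open>M\<close>. If \<open>M\<close> is directed,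
  this countable set is dominated by a monotone sequence in \<open>M\<close>, and its pointwise limit
  agrees with its right-continuous regularisation wherever the latter is continuous.\<close>

section \<open>The stochastic order in terms of distribution functions\<close>

text \<open>Right continuity of \<open>cdf \<mu>\<close>: let t decrease to s. It serves wherever an
  estimate is available only strictly to the right of s.\<close>

lemma le_cdf_if_le_right:
  assumes "real_distribution \<mu>" "\<And>t. s < t \<Longrightarrow> c \<le> cdf \<mu> t"
  shows "c \<le> cdf \<mu> s"
proof -
  interpret real_distribution \<mu> by fact
  show ?thesis
  proof (rule tendsto_lowerbound)
    show "(cdf \<mu> \<longlongrightarrow> cdf \<mu> s) (at_right s)"
      using cdf_is_right_cont[of s] by (simp add: continuous_within)
    show "\<forall>\<^sub>F t in at_right s. c \<le> cdf \<mu> t"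
      using assms(2) by (auto simp: eventually_at_right_field intro!: exI[of _ "s + 1"])
  qed simp
qed

lemma cdf_mono: "real_distribution \<mu> \<Longrightarrow> s \<le> t \<Longrightarrow> cdf \<mu> s \<le> cdf \<mu> t"
  by (intro finite_borel_measure.cdf_nondecreasing real_distribution.finite_borel_measure_M)

lemma upper_tail_eq_cdf:
  assumes "real_distribution \<mu>"
  shows "upper_tail \<mu> s = 1 - cdf \<mu> s"
proof -
  interpret real_distribution \<mu> by fact
  have "{s<..} = space \<mu> - {..s}" by auto
  then show ?thesis
    unfolding upper_tail_def cdf_def using prob_compl[of "{..s}"] by simp
qed

lemma le_st_iff_cdf_le:
  assumes "real_distribution \<mu>" "real_distribution \<nu>"
  shows "le_st \<mu> \<nu> \<longleftrightarrow> (\<forall>s. cdf \<nu> s \<le> cdf \<mu> s)"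
  using assms by (simp add: le_st_def upper_tail_eq_cdf)

lemma le_st_iff_cdf_le_rat:
  assumes "real_distribution \<mu>" "real_distribution \<nu>"
  shows "le_st \<mu> \<nu> \<longleftrightarrow> (\<forall>q\<in>\<rat>. cdf \<nu> q \<le> cdf \<mu> q)"
proof
  assume *: "\<forall>q\<in>\<rat>. cdf \<nu> q \<le> cdf \<mu> q"
  have "cdf \<nu> s \<le> cdf \<mu> s" for s
  proof (rule le_cdf_if_le_right[OF assms(1)])
    fix t assume "s < t"
    then obtain q where "q \<in> \<rat>" "s < q" "q < t" using Rats_dense_in_real by blast
    \<comment> \<open>Chain through q: \<open>cdf \<nu> s \<le> cdf \<nu> q \<le> cdf \<mu> q \<le>
      cdf \<mu> t\<close>.\<close>
    with * cdf_mono[OF assms(1), of q t] cdf_mono[OF assms(2), of s q]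
    show "cdf \<nu> s \<le> cdf \<mu> t" by fastforce
  qed
  then show "le_st \<mu> \<nu>" using assms by (simp add: le_st_iff_cdf_le)
qed (use assms in \<open>simp add: le_st_iff_cdf_le\<close>)

lemma carrier_prob_st [simp]: "\<mu> \<in> carrier prob_st \<longleftrightarrow> real_distribution \<mu>"
  by (simp add: prob_st_def)

lemma le_prob_st [simp]: "\<mu> \<sqsubseteq>\<^bsub>prob_st\<^esub> \<nu> \<longleftrightarrow> le_st \<mu> \<nu>"
  by (simp add: prob_st_def)

lemma le_st_trans: "le_st \<mu> \<nu> \<Longrightarrow> le_st \<nu> \<rho> \<Longrightarrow> le_st \<mu> \<rho>"
  unfolding le_st_def by (meson order_trans)

lemma partial_order_prob_st: "partial_order prob_st"
proof
  show "x .=\<^bsub>prob_st\<^esub> y"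
    if "x \<sqsubseteq>\<^bsub>prob_st\<^esub> y" "y \<sqsubseteq>\<^bsub>prob_st\<^esub> x" "x \<in> carrier prob_st" "y \<in> carrier prob_st" for x y
  proof -
    \<comment> \<open>Antisymmetry holds because a distribution function determines its
      measure.\<close>
    from that have "cdf x = cdf y"
      by (auto simp: le_st_iff_cdf_le fun_eq_iff intro: order_antisym)
    with that show ?thesis by (simp add: cdf_unique prob_st_def)
  qed
qed (auto simp: prob_st_def le_st_def intro: order_trans)

lemma Upper_prob_st_iff:
  assumes "A \<subseteq> carrier prob_st"
  shows "u \<in> Upper prob_st A \<longleftrightarrow>
    real_distribution u \<and> (\<forall>\<mu>\<in>A. \<forall>s. cdf u s \<le> cdf \<mu> s)"
  using assms by (auto simp: Upper_def le_st_iff_cdf_le subset_iff)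

lemma Lower_prob_st_iff:
  assumes "A \<subseteq> carrier prob_st"
  shows "l \<in> Lower prob_st A \<longleftrightarrow>
    real_distribution l \<and> (\<forall>\<mu>\<in>A. \<forall>s. cdf \<mu> s \<le> cdf l s)"
  using assms by (auto simp: Lower_def le_st_iff_cdf_le subset_iff)

section \<open>Right-continuous regularisation\<close>

text \<open>For monotone H and a probability measure \<nu> this says that \<open>cdf \<nu> s\<close>
  is the right limit of H at s. The two inequalities are the form in which comparisons of bounds use
  it.\<close>

definition cdf_regularises :: "real measure \<Rightarrow> (real \<Rightarrow> real) \<Rightarrow> bool" where
  "cdf_regularises \<nu> H \<longleftrightarrow> (\<forall>s. H s \<le> cdf \<nu> s) \<and> (\<forall>s t. s < t \<longrightarrow> cdf \<nu> s \<le> H t)"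

text \<open>The right limit F of H is again monotone, is right-continuous, and lies between H and a
  shift of H, so it has the limits of a distribution function; \<nu> is its Stieltjes
  measure.\<close>

lemma ex_cdf_regularises:
  fixes H :: "real \<Rightarrow> real"
  assumes "mono H" and bot: "(H \<longlongrightarrow> 0) at_bot" and top: "(H \<longlongrightarrow> 1) at_top"
  shows "\<exists>\<nu>. real_distribution \<nu> \<and> cdf_regularises \<nu> H"
proof -
  define F where "F s = (INF t\<in>{s<..}. H t)" for s
  have bdd: "bdd_below (H ` {s<..})" for s
    using monoD[OF \<open>mono H\<close>] by (intro bdd_belowI[of _ "H s"]) auto
  have upper: "F s \<le> H t" if "s < t" for s t
    unfolding F_def using that bdd by (auto intro!: cINF_lower)
  have lower: "H s \<le> F s" for s
    unfolding F_def using monoD[OF \<open>mono H\<close>] by (intro cINF_greatest) auto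
  have nondec: "F s \<le> F t" if "s \<le> t" for s t
    unfolding F_def using that bdd by (intro cINF_superset_mono) auto
  have right_cont: "continuous (at_right a) F" for a
  proof (subst continuous_at_right_real_increasing)
    show "\<forall>e>0. \<exists>d>0. F (a + d) - F a < e"
    proof (intro allI impI)
      fix e :: real assume "e > 0"
      then have "F a < F a + e" by simp
      \<comment> \<open>F a is an infimum, so some value H t with t > a is nearly attained; F stays
        below H t at every point left of t.\<close>
      then obtain t where t: "a < t" "H t < F a + e"
        unfolding F_def using bdd by (subst (asm) cINF_less_iff) auto
      obtain d where d: "d > 0" "a + d < t"
        using t(1) by (intro that[of "(t - a) / 2"]) (auto simp: field_simps)
      then have "F (a + d) - F a < e"
        using upper[of "a + d" t] t by simp
      with d show "\<exists>d>0. F (a + d) - F a < e" by blast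
    qed
  qed (use nondec in auto)
  \<comment> \<open>F s is at most H (s + 1), so the shifted H is the upper function of the squeeze
    at both ends.\<close>
  have shift: "((\<lambda>s. H (s + 1)) \<longlongrightarrow> 0) at_bot" "((\<lambda>s. H (s + 1)) \<longlongrightarrow> 1) at_top"
    by (rule filterlim_compose[OF bot] filterlim_compose[OF top], real_asymp)+
  have F_bot: "(F \<longlongrightarrow> 0) at_bot"
    using lower upper by (intro tendsto_sandwich[OF _ _ bot shift(1)] always_eventually) auto
  have F_top: "(F \<longlongrightarrow> 1) at_top"
    using lower upper by (intro tendsto_sandwich[OF _ _ top shift(2)] always_eventually) auto
  have "real_distribution (interval_measure F)"
    by (rule real_distribution_interval_measure[OF nondec right_cont F_bot F_top])
  moreover have "cdf (interval_measure F) = F"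
    by (rule cdf_interval_measure[OF nondec right_cont F_bot])
  ultimately show ?thesis
    using lower upper by (auto simp: cdf_regularises_def)
qed

section \<open>Suprema and infima of bounded sets\<close>

text \<open>The order is reversed on distribution functions, so the least upper bound comes from
  their pointwise infimum. Its link to \<open>cdf_regularises\<close> is recorded for the later
  proof of weak convergence.\<close>

lemma ex_is_lub_prob_st:
  assumes A: "A \<subseteq> carrier prob_st" "A \<noteq> {}" and "Upper prob_st A \<noteq> {}"
  shows "\<exists>\<nu>. is_lub prob_st \<nu> A \<and> cdf_regularises \<nu> (\<lambda>s. INF \<mu>\<in>A. cdf \<mu> s)"
proof -
  let ?H = "\<lambda>s. INF \<mu>\<in>A. cdf \<mu> s"
  obtain u where u: "real_distribution u" "\<And>\<mu> s. \<mu> \<in> A \<Longrightarrow> cdf u s \<le> cdf \<mu> s"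
    using assms Upper_prob_st_iff[OF A(1)] by blast
  obtain \<mu>0 where "\<mu>0 \<in> A" using A by blast
  have real: "real_distribution \<mu>" if "\<mu> \<in> A" for \<mu> using that A by auto
  interpret u: real_distribution u by fact
  interpret \<mu>0: real_distribution \<mu>0 using \<open>\<mu>0 \<in> A\<close> by (rule real)
  have bdd: "bdd_below ((\<lambda>\<mu>. cdf \<mu> s) ` A)" for s
    using u by (intro bdd_belowI[of _ "cdf u s"]) auto
  have H_le: "?H s \<le> cdf \<mu> s" if "\<mu> \<in> A" for \<mu> s
    using bdd that by (rule cINF_lower)
  have u_le: "cdf u s \<le> ?H s" for s
    using A u by (intro cINF_greatest) auto
  have H_le_1: "?H s \<le> 1" for s
    using H_le[OF \<open>\<mu>0 \<in> A\<close>, of s] \<mu>0.cdf_bounded_prob[of s] by linarith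
  have H_ge_0: "0 \<le> ?H s" for s
    using u_le[of s] u.cdf_nonneg[of s] by linarith
  have "mono ?H"
    by (intro monoI cINF_mono A(2) bdd) (metis cdf_mono real)
  \<comment> \<open>No mass escapes: a member of A lies above \<open>?H\<close> and forces the limit
    0 at minus infinity, while the upper bound u lies below \<open>?H\<close> and forces the limit 1
    at plus infinity.\<close>
  moreover have "(?H \<longlongrightarrow> 0) at_bot"
    using H_ge_0 H_le[OF \<open>\<mu>0 \<in> A\<close>]
    by (intro tendsto_sandwich[OF _ _ tendsto_const \<mu>0.cdf_lim_at_bot] always_eventually) auto
  moreover have "(?H \<longlongrightarrow> 1) at_top"
    using u_le H_le_1
    by (intro tendsto_sandwich[OF _ _ u.cdf_lim_at_top_prob tendsto_const] always_eventually) auto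
  ultimately obtain \<nu> where \<nu>: "real_distribution \<nu>" "cdf_regularises \<nu> ?H"
    using ex_cdf_regularises by blast
  have "cdf \<nu> s \<le> cdf \<mu> s" if "\<mu> \<in> A" for \<mu> s
  proof (rule le_cdf_if_le_right[OF real[OF that]])
    fix t assume "s < t"
    then have "cdf \<nu> s \<le> ?H t" using \<nu>(2) by (simp add: cdf_regularises_def)
    also have "\<dots> \<le> cdf \<mu> t" using that by (rule H_le)
    finally show "cdf \<nu> s \<le> cdf \<mu> t" .
  qed
  then have "\<nu> \<in> Upper prob_st A"
    using \<nu>(1) by (simp add: Upper_prob_st_iff[OF A(1)])
  moreover have "\<nu> \<sqsubseteq>\<^bsub>prob_st\<^esub> v" if "v \<in> Upper prob_st A" for v
  proof -
    from that have v: "real_distribution v" "\<And>\<mu> s. \<mu> \<in> A \<Longrightarrow> cdf v s \<le> cdf \<mu> s"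
      using Upper_prob_st_iff[OF A(1)] by auto
    have "cdf v s \<le> cdf \<nu> s" for s
    proof -
      have "cdf v s \<le> ?H s" using A v by (intro cINF_greatest) auto
      also have "\<dots> \<le> cdf \<nu> s" using \<nu>(2) by (simp add: cdf_regularises_def)
      finally show ?thesis .
    qed
    with \<nu>(1) v(1) show ?thesis by (simp add: le_st_iff_cdf_le)
  qed
  ultimately have "is_lub prob_st \<nu> A"
    by (auto simp: least_def Upper_def)
  with \<nu> show ?thesis by blast
qed

text \<open>Dual construction from the pointwise supremum, with the member and the bound exchanging
  their roles in the limits. A supremum of right-continuous functions can fail to be
  right-continuous, so the regularisation can change it here.\<close>

lemma ex_is_glb_prob_st:
  assumes A: "A \<subseteq> carrier prob_st" "A \<noteq> {}" and "Lower prob_st A \<noteq> {}"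
  shows "\<exists>\<nu>. is_glb prob_st \<nu> A \<and> cdf_regularises \<nu> (\<lambda>s. SUP \<mu>\<in>A. cdf \<mu> s)"
proof -
  let ?H = "\<lambda>s. SUP \<mu>\<in>A. cdf \<mu> s"
  obtain l where l: "real_distribution l" "\<And>\<mu> s. \<mu> \<in> A \<Longrightarrow> cdf \<mu> s \<le> cdf l s"
    using assms Lower_prob_st_iff[OF A(1)] by blast
  obtain \<mu>0 where "\<mu>0 \<in> A" using A by blast
  have real: "real_distribution \<mu>" if "\<mu> \<in> A" for \<mu> using that A by auto
  interpret l: real_distribution l by fact
  interpret \<mu>0: real_distribution \<mu>0 using \<open>\<mu>0 \<in> A\<close> by (rule real)
  have bdd: "bdd_above ((\<lambda>\<mu>. cdf \<mu> s) ` A)" for s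
    using l by (intro bdd_aboveI[of _ "cdf l s"]) auto
  have le_H: "cdf \<mu> s \<le> ?H s" if "\<mu> \<in> A" for \<mu> s
    using that bdd by (rule cSUP_upper)
  have le_l: "?H s \<le> cdf l s" for s
    using A l by (intro cSUP_least) auto
  have H_le_1: "?H s \<le> 1" for s
    using le_l[of s] l.cdf_bounded_prob[of s] by linarith
  have H_ge_0: "0 \<le> ?H s" for s
    using le_H[OF \<open>\<mu>0 \<in> A\<close>, of s] \<mu>0.cdf_nonneg[of s] by linarith
  have "mono ?H"
    by (intro monoI cSUP_mono A(2) bdd) (metis cdf_mono real)
  moreover have "(?H \<longlongrightarrow> 0) at_bot"
    using H_ge_0 le_l
    by (intro tendsto_sandwich[OF _ _ tendsto_const l.cdf_lim_at_bot] always_eventually) auto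
  moreover have "(?H \<longlongrightarrow> 1) at_top"
    using le_H[OF \<open>\<mu>0 \<in> A\<close>] H_le_1
    by (intro tendsto_sandwich[OF _ _ \<mu>0.cdf_lim_at_top_prob tendsto_const] always_eventually) auto
  ultimately obtain \<nu> where \<nu>: "real_distribution \<nu>" "cdf_regularises \<nu> ?H"
    using ex_cdf_regularises by blast
  have "cdf \<mu> s \<le> cdf \<nu> s" if "\<mu> \<in> A" for \<mu> s
    using order_trans[OF le_H[OF that]] \<nu>(2) by (simp add: cdf_regularises_def)
  then have "\<nu> \<in> Lower prob_st A"
    using \<nu>(1) by (simp add: Lower_prob_st_iff[OF A(1)])
  moreover have "v \<sqsubseteq>\<^bsub>prob_st\<^esub> \<nu>" if "v \<in> Lower prob_st A" for v
  proof -
    from that have v: "real_distribution v" "\<And>\<mu> s. \<mu> \<in> A \<Longrightarrow> cdf \<mu> s \<le> cdf v s"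
      using Lower_prob_st_iff[OF A(1)] by auto
    \<comment> \<open>Since \<open>cdf \<nu> s\<close> may exceed \<open>?H s\<close>, the
      comparison is made at t > s and carried back by the right continuity of
      \<open>cdf v\<close>.\<close>
    have "cdf \<nu> s \<le> cdf v s" for s
    proof (rule le_cdf_if_le_right[OF v(1)])
      fix t assume "s < t"
      then have "cdf \<nu> s \<le> ?H t" using \<nu>(2) by (simp add: cdf_regularises_def)
      also have "\<dots> \<le> cdf v t" using A v by (intro cSUP_least) auto
      finally show "cdf \<nu> s \<le> cdf v t" .
    qed
    with \<nu>(1) v(1) show ?thesis by (simp add: le_st_iff_cdf_le)
  qed
  ultimately have "is_glb prob_st \<nu> A"
    by (auto simp: greatest_def Lower_def)
  with \<nu> show ?thesis by blast
qed

text \<open>Supplies the bounds from which joins and meets of pairs follow as bounded suprema and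
  infima: the pointwise minimum and maximum of two distribution functions still have limits 0 and
  1.\<close>

lemma pair_bounded_prob_st:
  assumes x: "x \<in> carrier prob_st" and y: "y \<in> carrier prob_st"
  shows "Upper prob_st {x, y} \<noteq> {}" "Lower prob_st {x, y} \<noteq> {}"
proof -
  interpret x: real_distribution x using x by simp
  interpret y: real_distribution y using y by simp
  have xy: "{x, y} \<subseteq> carrier prob_st" using x y by simp
  have "mono (\<lambda>s. min (cdf x s) (cdf y s))" "mono (\<lambda>s. max (cdf x s) (cdf y s))"
    by (auto intro!: monoI min.mono max.mono x.cdf_nondecreasing y.cdf_nondecreasing)
  moreover have "((\<lambda>s. min (cdf x s) (cdf y s)) \<longlongrightarrow> 0) at_bot" "((\<lambda>s. max (cdf x s) (cdf y s)) \<longlongrightarrow> 0) at_bot"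
    using tendsto_min[OF x.cdf_lim_at_bot y.cdf_lim_at_bot]
      tendsto_max[OF x.cdf_lim_at_bot y.cdf_lim_at_bot] by auto
  moreover have "((\<lambda>s. min (cdf x s) (cdf y s)) \<longlongrightarrow> 1) at_top" "((\<lambda>s. max (cdf x s) (cdf y s)) \<longlongrightarrow> 1) at_top"
    using tendsto_min[OF x.cdf_lim_at_top_prob y.cdf_lim_at_top_prob]
      tendsto_max[OF x.cdf_lim_at_top_prob y.cdf_lim_at_top_prob] by auto
  ultimately obtain u l
    where u: "real_distribution u" "cdf_regularises u (\<lambda>s. min (cdf x s) (cdf y s))"
      and l: "real_distribution l" "cdf_regularises l (\<lambda>s. max (cdf x s) (cdf y s))"
    using ex_cdf_regularises by meson
  have "cdf u s \<le> cdf x s" "cdf u s \<le> cdf y s" for s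
    by (rule le_cdf_if_le_right; use u(2) x y in \<open>simp add: cdf_regularises_def\<close>)+
  with u(1) have "u \<in> Upper prob_st {x, y}"
    by (simp add: Upper_prob_st_iff[OF xy])
  then show "Upper prob_st {x, y} \<noteq> {}" by blast
  have "cdf x s \<le> cdf l s" "cdf y s \<le> cdf l s" for s
    using l(2) by (auto simp: cdf_regularises_def)
  with l(1) have "l \<in> Lower prob_st {x, y}"
    by (simp add: Lower_prob_st_iff[OF xy])
  then show "Lower prob_st {x, y} \<noteq> {}" by blast
qed

section \<open>Countable subsets with the same bounds, and super completeness\<close>

text \<open>C takes one witness for each index i and each rational r that \<open>f i\<close> exceeds
  somewhere on A. If \<open>f i x\<close> exceeded c, the witness for a rational between them would
  exceed c as well. Bounds in place of suprema also cover an \<open>f i\<close> that is unbounded on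
  A.\<close>

lemma countable_subset_same_upper_bounds:
  fixes f :: "'i \<Rightarrow> 'a \<Rightarrow> real"
  assumes "countable I"
  obtains C where "C \<subseteq> A" "countable C"
    "\<And>i c x. i \<in> I \<Longrightarrow> \<forall>y\<in>C. f i y \<le> c \<Longrightarrow> x \<in> A \<Longrightarrow> f i x \<le> c"
proof
  define J where "J = {(i, r). i \<in> I \<and> r \<in> \<rat> \<and> (\<exists>x\<in>A. r < f i x)}"
  define g where "g = (\<lambda>(i, r). SOME x. x \<in> A \<and> r < f i x)"
  have g: "g (i, r) \<in> A \<and> r < f i (g (i, r))" if "(i, r) \<in> J" for i r
    using that unfolding g_def J_def by (auto intro: someI2_bex)
  show "g ` J \<subseteq> A" using g by auto
  have "countable (I \<times> (\<rat> :: real set))"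
    using assms countable_rat by (rule countable_SIGMA)
  then show "countable (g ` J)"
    by (rule countable_image[OF countable_subset[rotated]]) (auto simp: J_def)
  fix i c x assume i: "i \<in> I" and c: "\<forall>y\<in>g ` J. f i y \<le> c" and x: "x \<in> A"
  show "f i x \<le> c"
  proof (rule ccontr)
    assume "\<not> f i x \<le> c"
    then obtain r where r: "r \<in> \<rat>" "c < r" "r < f i x"
      using Rats_dense_in_real[of c "f i x"] by auto
    with i x have "(i, r) \<in> J" by (auto simp: J_def)
    with g c r show False by fastforce
  qed
qed

text \<open>Values at rational points decide the order, so countably many functionals have to be
  controlled. Equal sets of bounds carry both the supremum and the infimum of A over to C.\<close>

lemma countable_subset_same_bounds_prob_st:
  assumes A: "A \<subseteq> carrier prob_st"
  obtains C where "C \<subseteq> A" "countable C"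
    "Upper prob_st C = Upper prob_st A" "Lower prob_st C = Lower prob_st A"
proof -
  \<comment> \<open>The flag b selects the sign, so that one set C controls the values at q from
    above and from below.\<close>
  define f where "f = (\<lambda>(q, b) \<mu>. if b then cdf \<mu> q else - cdf \<mu> q)"
  have "countable ((\<rat> :: real set) \<times> (UNIV :: bool set))"
    by (intro countable_SIGMA countable_rat) auto
  then obtain C where C: "C \<subseteq> A" "countable C"
    "\<And>i c x. i \<in> \<rat> \<times> UNIV \<Longrightarrow> \<forall>y\<in>C. f i y \<le> c \<Longrightarrow> x \<in> A \<Longrightarrow> f i x \<le> c"
    by (rule countable_subset_same_upper_bounds[where f = f and A = A]) blast
  have upper: "cdf x q \<le> c" if "q \<in> \<rat>" "\<forall>y\<in>C. cdf y q \<le> c" "x \<in> A" for q c x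
    using C(3)[of "(q, True)" c x] that by (simp add: f_def)
  have lower: "c \<le> cdf x q" if "q \<in> \<rat>" "\<forall>y\<in>C. c \<le> cdf y q" "x \<in> A" for q c x
    using C(3)[of "(q, False)" "- c" x] that by (simp add: f_def)
  have C_carrier: "C \<subseteq> carrier prob_st" using C(1) A by blast
  have "Upper prob_st C \<subseteq> Upper prob_st A"
  proof
    fix u assume u: "u \<in> Upper prob_st C"
    have "le_st x u" if x: "x \<in> A" for x
    proof -
      have "cdf u q \<le> cdf x q" if "q \<in> \<rat>" for q
        using u by (intro lower[OF that _ x]) (simp add: Upper_prob_st_iff[OF C_carrier])
      moreover have "real_distribution u" "real_distribution x"
        using u x A by (auto simp: Upper_def)
      ultimately show ?thesis by (simp add: le_st_iff_cdf_le_rat)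
    qed
    with u show "u \<in> Upper prob_st A" by (simp add: Upper_def)
  qed
  moreover have "Lower prob_st C \<subseteq> Lower prob_st A"
  proof
    fix l assume l: "l \<in> Lower prob_st C"
    have "le_st l x" if x: "x \<in> A" for x
    proof -
      have "cdf x q \<le> cdf l q" if "q \<in> \<rat>" for q
        using l by (intro upper[OF that _ x]) (simp add: Lower_prob_st_iff[OF C_carrier])
      moreover have "real_distribution l" "real_distribution x"
        using l x A by (auto simp: Lower_def)
      ultimately show ?thesis by (simp add: le_st_iff_cdf_le_rat)
    qed
    with l show "l \<in> Lower prob_st A" by (simp add: Lower_def)
  qed
  ultimately show thesis
    by (intro that[OF C(1,2)] subset_antisym Upper_antimono[OF C(1)] Lower_antimono[OF C(1)])
qed

lemma dedekind_super_complete_prob_st: "dedekind_super_complete_lattice prob_st"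
proof -
  interpret partial_order prob_st by (rule partial_order_prob_st)
  show ?thesis
  proof
    fix x y assume xy: "x \<in> carrier prob_st" "y \<in> carrier prob_st"
    show "\<exists>s. is_lub prob_st s {x, y}"
      using ex_is_lub_prob_st[of "{x, y}"] pair_bounded_prob_st[OF xy] xy by auto
    show "\<exists>s. is_glb prob_st s {x, y}"
      using ex_is_glb_prob_st[of "{x, y}"] pair_bounded_prob_st[OF xy] xy by auto
  next
    fix A assume A: "A \<subseteq> carrier prob_st" "A \<noteq> {}"
    \<comment> \<open>\<open>is_lub\<close> and \<open>is_glb\<close> depend on a set only through
      its upper and lower bounds, so those of A are those of C.\<close>
    obtain C where C: "C \<subseteq> A" "countable C"
      "Upper prob_st C = Upper prob_st A" "Lower prob_st C = Lower prob_st A"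
      using countable_subset_same_bounds_prob_st[OF A(1)] .
    show "\<exists>s. is_lub prob_st s A \<and> (\<exists>C\<subseteq>A. countable C \<and> is_lub prob_st s C)"
      if "Upper prob_st A \<noteq> {}"
      using ex_is_lub_prob_st[OF A that] C by metis
    show "\<exists>s. is_glb prob_st s A \<and> (\<exists>C\<subseteq>A. countable C \<and> is_glb prob_st s C)"
      if "Lower prob_st A \<noteq> {}"
      using ex_is_glb_prob_st[OF A that] C by metis
  qed
qed

section \<open>Monotone sequences and weak convergence\<close>

text \<open>Weak convergence tests only continuity points x of \<open>cdf \<nu>\<close>. There
  \<open>cdf \<nu> s \<le> H x\<close> for s < x passes to the left limit, so H x and
  \<open>cdf \<nu> x\<close> coincide.\<close>

lemma weak_conv_m_if_cdf_regularises:
  assumes "real_distribution \<nu>" and \<nu>: "cdf_regularises \<nu> H"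
    and lim: "\<And>s. (\<lambda>n. cdf (\<mu> n) s) \<longlonglongrightarrow> H s"
  shows "weak_conv_m \<mu> \<nu>"
  unfolding weak_conv_m_def weak_conv_def
proof (intro allI impI)
  fix x assume "isCont (cdf \<nu>) x"
  then have "(cdf \<nu> \<longlongrightarrow> cdf \<nu> x) (at_left x)"
    by (simp add: isCont_def filterlim_at_split)
  moreover have "\<forall>\<^sub>F s in at_left x. cdf \<nu> s \<le> H x"
    using \<nu> by (auto simp: cdf_regularises_def eventually_at_left_field intro!: exI[of _ "x - 1"])
  ultimately have "cdf \<nu> x \<le> H x"
    by (rule tendsto_upperbound) simp
  with \<nu> have "H x = cdf \<nu> x"
    by (simp add: cdf_regularises_def antisym)
  with lim[of x] show "(\<lambda>n. cdf (\<mu> n) x) \<longlonglongrightarrow> cdf \<nu> x" by simp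
qed

text \<open>Enumerate C and choose each term above both its predecessor and the next element of the
  enumeration. The relation R is left abstract so that the stochastic order and its reverse can both
  be inserted.\<close>

lemma directed_countable_chain:
  assumes "M \<noteq> {}" "C \<subseteq> M" "countable C"
    and directed: "\<And>x y. x \<in> M \<Longrightarrow> y \<in> M \<Longrightarrow> \<exists>z\<in>M. R x z \<and> R y z"
  shows "\<exists>f :: nat \<Rightarrow> 'a. (\<forall>n. f n \<in> M) \<and> (\<forall>n. R (f n) (f (Suc n))) \<and> (\<forall>c\<in>C. \<exists>n. R c (f n))"
proof -
  obtain x where "x \<in> M" using assms(1) by blast
  \<comment> \<open>C may be empty; inserting x makes the set nonempty, so that it is the range of a
    sequence.\<close>
  define c where "c = from_nat_into (insert x C)"
  have c: "range c = insert x C"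
    using assms(3) unfolding c_def by (intro range_from_nat_into) auto
  have cM: "c n \<in> M" for n
    using rangeI[of c n] assms(2) \<open>x \<in> M\<close> unfolding c by blast
  have "\<exists>f. \<forall>n. (f n \<in> M \<and> R (c n) (f n)) \<and> R (f n) (f (Suc n))"
  proof (rule dependent_nat_choice)
    show "\<exists>x. x \<in> M \<and> R (c 0) x"
      using directed[OF cM cM] by blast
    show "\<exists>y. (y \<in> M \<and> R (c (Suc n)) y) \<and> R x y" if "x \<in> M \<and> R (c n) x" for x n
      using directed[of x "c (Suc n)"] that cM by blast
  qed
  then obtain f where "\<And>n. f n \<in> M" "\<And>n. R (c n) (f n)" "\<And>n. R (f n) (f (Suc n))"
    by blast
  moreover have "\<exists>n. y = c n" if "y \<in> C" for y
    using that c by blast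
  ultimately show ?thesis by metis
qed

text \<open>A chain in M that dominates the countable set C has the same upper bounds as M, hence
  the same supremum, and the distribution functions along it decrease to the infimum that this
  supremum regularises.\<close>

lemma directed_up_weak_conv_sup:
  assumes M: "M \<subseteq> carrier prob_st" "M \<noteq> {}" and bdd: "Upper prob_st M \<noteq> {}"
    and dir: "directed_up prob_st M"
  shows "\<exists>\<mu> :: nat \<Rightarrow> real measure. (\<forall>n. \<mu> n \<in> M) \<and>
    (\<forall>n. \<mu> n \<sqsubseteq>\<^bsub>prob_st\<^esub> \<mu> (Suc n)) \<and> weak_conv_m \<mu> (\<Squnion>\<^bsub>prob_st\<^esub> M)"
proof -
  interpret dedekind_super_complete_lattice prob_st by (rule dedekind_super_complete_prob_st)
  obtain C where C: "C \<subseteq> M" "countable C" "Upper prob_st C = Upper prob_st M"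
    using countable_subset_same_bounds_prob_st[OF M(1)] by metis
  have "\<exists>z\<in>M. le_st x z \<and> le_st y z" if "x \<in> M" "y \<in> M" for x y
  proof -
    from dir that obtain z where "z \<in> M" "le_st (x \<squnion>\<^bsub>prob_st\<^esub> y) z"
      by (auto simp: directed_up_def)
    moreover have xy: "x \<in> carrier prob_st" "y \<in> carrier prob_st"
      using that M(1) by auto
    moreover have "le_st x (x \<squnion>\<^bsub>prob_st\<^esub> y)" "le_st y (x \<squnion>\<^bsub>prob_st\<^esub> y)"
      using join_left[OF xy] join_right[OF xy] by simp_all
    ultimately show ?thesis
      using le_st_trans by blast
  qed
  from directed_countable_chain[OF M(2) C(1,2), of le_st, OF this]
  obtain \<mu> where \<mu>: "\<And>n :: nat. \<mu> n \<in> M" "\<And>n. le_st (\<mu> n) (\<mu> (Suc n))"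
    "\<And>c. c \<in> C \<Longrightarrow> \<exists>n. le_st c (\<mu> n)"
    by blast
  have real: "real_distribution (\<mu> n)" for n
    using subsetD[OF M(1) \<mu>(1)] by simp
  \<comment> \<open>Each element of C lies below some term of the chain, so a bound of the chain
    bounds C, and therefore M.\<close>
  have "Upper prob_st (range \<mu>) \<subseteq> Upper prob_st C"
  proof
    fix u assume u: "u \<in> Upper prob_st (range \<mu>)"
    have "le_st c u" if c: "c \<in> C" for c
    proof -
      obtain n where "le_st c (\<mu> n)" using \<mu>(3)[OF c] by blast
      moreover have "le_st (\<mu> n) u" using u real by (simp add: Upper_def)
      ultimately show ?thesis using le_st_trans by blast
    qed
    with u show "u \<in> Upper prob_st C" by (simp add: Upper_def)
  qed
  moreover have "range \<mu> \<subseteq> M" using \<mu>(1) by (rule image_subsetI)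
  ultimately have Upper_eq: "Upper prob_st (range \<mu>) = Upper prob_st M"
    by (simp add: C(3) subset_antisym Upper_antimono)
  have range_carrier: "range \<mu> \<subseteq> carrier prob_st" "range \<mu> \<noteq> {}"
    using real by auto
  obtain \<nu> where \<nu>: "is_lub prob_st \<nu> (range \<mu>)" "cdf_regularises \<nu> (\<lambda>s. INF \<rho>\<in>range \<mu>. cdf \<rho> s)"
    using ex_is_lub_prob_st[of "range \<mu>"] range_carrier bdd unfolding Upper_eq by blast
  \<comment> \<open>The supremum operator is a choice among least upper bounds; uniqueness
    identifies the choice with \<nu>.\<close>
  have "\<nu> = \<Squnion>\<^bsub>prob_st\<^esub> M"
    unfolding sup_def using \<nu>(1) Upper_eq by (metis least_unique someI)
  moreover have "weak_conv_m \<mu> \<nu>"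
  proof (rule weak_conv_m_if_cdf_regularises[OF _ \<nu>(2)])
    show "real_distribution \<nu>" using least_closed[OF \<nu>(1)] by simp
    fix s
    have "decseq (\<lambda>n. cdf (\<mu> n) s)"
      using \<mu>(2) real by (auto intro!: decseq_SucI simp: le_st_iff_cdf_le)
    moreover have "bdd_below (range (\<lambda>n. cdf (\<mu> n) s))"
      by (intro bdd_belowI[of _ 0]) (auto simp: cdf_def)
    ultimately show "(\<lambda>n. cdf (\<mu> n) s) \<longlonglongrightarrow> (INF \<rho>\<in>range \<mu>. cdf \<rho> s)"
      by (simp add: image_image LIMSEQ_decseq_INF)
  qed
  ultimately show ?thesis using \<mu> by auto
qed

text \<open>The chain is built for the reversed order, and the distribution functions increase along
  it. Their pointwise limit can differ from the distribution function of the infimum at its jumps,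
  as for point masses at 1/n; weak convergence ignores these points.\<close>

lemma directed_down_weak_conv_inf:
  assumes M: "M \<subseteq> carrier prob_st" "M \<noteq> {}" and bdd: "Lower prob_st M \<noteq> {}"
    and dir: "directed_down prob_st M"
  shows "\<exists>\<mu> :: nat \<Rightarrow> real measure. (\<forall>n. \<mu> n \<in> M) \<and>
    (\<forall>n. \<mu> (Suc n) \<sqsubseteq>\<^bsub>prob_st\<^esub> \<mu> n) \<and> weak_conv_m \<mu> (\<Sqinter>\<^bsub>prob_st\<^esub> M)"
proof -
  interpret dedekind_super_complete_lattice prob_st by (rule dedekind_super_complete_prob_st)
  obtain C where C: "C \<subseteq> M" "countable C" "Lower prob_st C = Lower prob_st M"
    using countable_subset_same_bounds_prob_st[OF M(1)] by metis
  have "\<exists>z\<in>M. le_st z x \<and> le_st z y" if "x \<in> M" "y \<in> M" for x y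
  proof -
    from dir that obtain z where "z \<in> M" "le_st z (x \<sqinter>\<^bsub>prob_st\<^esub> y)"
      by (auto simp: directed_down_def)
    moreover have xy: "x \<in> carrier prob_st" "y \<in> carrier prob_st"
      using that M(1) by auto
    moreover have "le_st (x \<sqinter>\<^bsub>prob_st\<^esub> y) x" "le_st (x \<sqinter>\<^bsub>prob_st\<^esub> y) y"
      using meet_left[OF xy] meet_right[OF xy] by simp_all
    ultimately show ?thesis
      using le_st_trans by blast
  qed
  from directed_countable_chain[OF M(2) C(1,2), of "\<lambda>x y. le_st y x", OF this]
  obtain \<mu> where \<mu>: "\<And>n :: nat. \<mu> n \<in> M" "\<And>n. le_st (\<mu> (Suc n)) (\<mu> n)"
    "\<And>c. c \<in> C \<Longrightarrow> \<exists>n. le_st (\<mu> n) c"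
    by blast
  have real: "real_distribution (\<mu> n)" for n
    using subsetD[OF M(1) \<mu>(1)] by simp
  \<comment> \<open>Each element of C lies above some term of the chain, so a lower bound of the
    chain is one of C, and therefore of M.\<close>
  have "Lower prob_st (range \<mu>) \<subseteq> Lower prob_st C"
  proof
    fix l assume l: "l \<in> Lower prob_st (range \<mu>)"
    have "le_st l c" if c: "c \<in> C" for c
    proof -
      obtain n where "le_st (\<mu> n) c" using \<mu>(3)[OF c] by blast
      moreover have "le_st l (\<mu> n)" using l real by (simp add: Lower_def)
      ultimately show ?thesis using le_st_trans by blast
    qed
    with l show "l \<in> Lower prob_st C" by (simp add: Lower_def)
  qed
  moreover have "range \<mu> \<subseteq> M" using \<mu>(1) by (rule image_subsetI)
  ultimately have Lower_eq: "Lower prob_st (range \<mu>) = Lower prob_st M"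
    by (simp add: C(3) subset_antisym Lower_antimono)
  have range_carrier: "range \<mu> \<subseteq> carrier prob_st" "range \<mu> \<noteq> {}"
    using real by auto
  obtain \<nu> where \<nu>: "is_glb prob_st \<nu> (range \<mu>)" "cdf_regularises \<nu> (\<lambda>s. SUP \<rho>\<in>range \<mu>. cdf \<rho> s)"
    using ex_is_glb_prob_st[of "range \<mu>"] range_carrier bdd unfolding Lower_eq by blast
  have "\<nu> = \<Sqinter>\<^bsub>prob_st\<^esub> M"
    unfolding inf_def using \<nu>(1) Lower_eq by (metis greatest_unique someI)
  moreover have "weak_conv_m \<mu> \<nu>"
  proof (rule weak_conv_m_if_cdf_regularises[OF _ \<nu>(2)])
    show "real_distribution \<nu>" using greatest_closed[OF \<nu>(1)] by simp
    fix s
    have "incseq (\<lambda>n. cdf (\<mu> n) s)"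
      using \<mu>(2) real by (auto intro!: incseq_SucI simp: le_st_iff_cdf_le)
    moreover have "bdd_above (range (\<lambda>n. cdf (\<mu> n) s))"
      using real real_distribution.cdf_bounded_prob by (intro bdd_aboveI[of _ 1]) auto
    ultimately show "(\<lambda>n. cdf (\<mu> n) s) \<longlonglongrightarrow> (SUP \<rho>\<in>range \<mu>. cdf \<rho> s)"
      by (simp add: image_image LIMSEQ_incseq_SUP)
  qed
  ultimately show ?thesis using \<mu> by auto
qed

theorem corollary3p3:
  shows "dedekind_super_complete_lattice prob_st \<and>
    (\<forall>M. M \<subseteq> carrier prob_st \<and> M \<noteq> {} \<longrightarrow>
      (Upper prob_st M \<noteq> {} \<and> directed_up prob_st M \<longrightarrow>
        (\<exists>\<mu> :: nat \<Rightarrow> real measure. (\<forall>n. \<mu> n \<in> M) \<and>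
          (\<forall>n. \<mu> n \<sqsubseteq>\<^bsub>prob_st\<^esub> \<mu> (Suc n)) \<and> weak_conv_m \<mu> (\<Squnion>\<^bsub>prob_st\<^esub> M))) \<and>
      (Lower prob_st M \<noteq> {} \<and> directed_down prob_st M \<longrightarrow>
        (\<exists>\<mu> :: nat \<Rightarrow> real measure. (\<forall>n. \<mu> n \<in> M) \<and>
          (\<forall>n. \<mu> (Suc n) \<sqsubseteq>\<^bsub>prob_st\<^esub> \<mu> n) \<and> weak_conv_m \<mu> (\<Sqinter>\<^bsub>prob_st\<^esub> M))))"
  using dedekind_super_complete_prob_st directed_up_weak_conv_sup directed_down_weak_conv_inf
  by blast

end
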